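(* Let $\mathfrak C^{(0)}_{-1/2}(q;t):=\mathrm{tr}_{\mathcal F^{-1/2}}\big(q^{L_0}\mathsf C(t)\big)=\sum_\lambda q^{|\lambda|-\ell(\lambda)/2}\Big(\sum_{i=1}^{\ell(\lambda)}(t^{\lambda_i-1/2}-t^{-\lambda_i+1/2})+\frac{1}{t^{-1/2}-t^{1/2}}\Big)$ (sum over all partitions $\lambda$). Then $$\mathfrak C^{(0)}_{-1/2}(q;t)=\frac{1}{(q^{1/2})_\infty(t^{-1/2}-t^{1/2})}-\frac{1}{(q^{1/2})_\infty(1-q^{-1/2})}\frac{t^{1/2}(tq^{3/2})_\infty}{(tq)_\infty}{}_2\Phi_2(q^{1/2},q^{1/2};q^{3/2},tq^{3/2};q^2t) +\frac{1}{(q^{1/2})_\infty(1-q^{-1/2})}\frac{t^{-1/2}(t^{-1}q^{3/2})_\infty}{(t^{-1}q)_\infty}{}_2\Phi_2(q^{1/2},q^{1/2};q^{3/2},t^{-1}q^{3/2};q^2t^{-1}).$$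
   Context: $\mathcal F^{-1/2}$ is the Fock space of a bosonic field with modes $\chi_r$, $r\in\frac12+\mathbb Z$, $[\chi_r,\chi_s]=(-1)^{r+1/2}\delta_{r+s,0}$, $\chi_r|0\rangle=0$ for $r>0$; it has basis $v_\lambda=\chi_{-\lambda_1+1/2}\chi_{-\lambda_2+1/2}\cdots|0\rangle$ over partitions $\lambda$. $L_0v_\lambda=(|\lambda|-\ell(\lambda)/2)v_\lambda$ and the operator $\mathsf C(t)=\sum_{r\in\frac12+\mathbb Z}(-1)^{r+1/2}t^r\chi_{-r}\chi_r$ acts by $\mathsf C(t)v_\lambda=\big(\sum_{i=1}^{\ell(\lambda)}(t^{\lambda_i-1/2}-t^{-\lambda_i+1/2})+\frac{1}{t^{-1/2}-t^{1/2}}\big)v_\lambda$. Notation: $(a)_n=(1-a)\cdots(1-aq^{n-1})$, $(a)_\infty=\prod_{i\ge0}(1-aq^i)$, ${}_r\Phi_s(a_1,\dots,a_r;b_1,\dots,b_s;z)=\sum_{n\ge0}\frac{(a_1)_n\cdots(a_r)_n}{(b_1)_n\cdots(b_s)_n(q)_n}\big((-1)^nq^{n(n-1)/2}\big)^{1+s-r}z^n$. *)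

theory Defs
  imports "HOL-Analysis.Analysis"
begin

definition is_partition :: "nat list \<Rightarrow> bool" where
  "is_partition xs \<longleftrightarrow> sorted_wrt (\<ge>) xs \<and> (\<forall>a\<in>set xs. 0 < a)"

definition qpoch :: "complex \<Rightarrow> complex \<Rightarrow> nat \<Rightarrow> complex" where
  "qpoch q a n = (\<Prod>i<n. 1 - a * q ^ i)"

definition qpoch_inf :: "complex \<Rightarrow> complex \<Rightarrow> complex" where
  "qpoch_inf q a = (\<Prod>i. 1 - a * q ^ i)"

definition qPhi :: "complex \<Rightarrow> complex list \<Rightarrow> complex list \<Rightarrow> complex \<Rightarrow> complex" where
  "qPhi q as bs z = (\<Sum>n.
      (\<Prod>a\<leftarrow>as. qpoch q a n) / ((\<Prod>b\<leftarrow>bs. qpoch q b n) * qpoch q q n)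
      * ((-1) ^ n * q ^ (n * (n - 1) div 2)) powi (1 + int (length bs) - int (length as))
      * z ^ n)"

text \<open>The summand of the trace: q^(|lambda| - l(lambda)/2) times the C(t)-eigenvalue,
  written with x = q^(1/2), y = t^(1/2).\<close>
definition trace_term :: "complex \<Rightarrow> complex \<Rightarrow> nat list \<Rightarrow> complex" where
  "trace_term x y lam = x ^ (2 * sum_list lam - length lam) *
     ((\<Sum>l\<leftarrow>lam. y ^ (2 * l - 1) - inverse y ^ (2 * l - 1)) + 1 / (inverse y - y))"

end

theory Submission
  imports Defs "HOL-Library.Multiset"
begin

text \<open>
  Write \<open>w\<^sub>l = x ^ (2 * l - 1)\<close>. In the generating function \<open>\<Prod>l. 1 / (1 - w\<^sub>l) = 1 / qpoch_inf q x\<close>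
  of partitions the part \<open>l\<close> has mean multiplicity \<open>w\<^sub>l / (1 - w\<^sub>l)\<close>. The trace is therefore
  \<open>1 / qpoch_inf q x\<close> times a difference of two Lambert series \<open>F z = (\<Sum>n. z ^ n / (1 - x * q ^ n))\<close>,
  at \<open>z = t * q\<close> and \<open>z = q / t\<close>, plus the constant. As \<open>(1 - x) * F z\<close> is the series
  \<open>2Phi1(x, q; x * q; z)\<close>, Jackson's transformation turns it into the stated \<open>2Phi2\<close>.

  That instance of the transformation follows from uniqueness of bounded solutions of \<open>q\<close>-difference
  equations: \<open>F z - x * F (z * q) = 1 / (1 - z)\<close>, and the transformed side satisfies the same
  equation by the summation \<open>1Phi1(x; x * w; w) = qpoch_inf q w / qpoch_inf q (x * w)\<close>, which has a
  similar proof.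
\<close>

subsection \<open>Weighted sums over multisets\<close>

text \<open>A finite subset of the union lies in a single \<open>U k\<close>, so the sums over the
  \<open>U k\<close> approach the unordered sum. This evaluates a sum over all multisets by bounding
  the parts, once summability is known.\<close>

lemma has_sum_incseq_unique:
  fixes g :: "'a \<Rightarrow> 'b :: {t2_space, topological_comm_monoid_add, real_normed_vector}"
  assumes sum: "(g has_sum S) (\<Union>k. U k)" and U: "incseq U"
    and part: "\<And>k. (g has_sum s k) (U k)" and lim: "s \<longlonglongrightarrow> s'"
  shows "S = s'"
proof -
  have "s \<longlonglongrightarrow> S"
  proof (rule tendstoI)
    fix e :: real assume "e > 0"
    \<comment> \<open>Passing to the limit over finite subsets of \<open>U k\<close> preserves only
      a weak inequality; halving \<open>e\<close> recovers the strict one.\<close>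
    then have "e / 2 > 0" by simp
    from tendstoD[OF sum[unfolded has_sum_def] this]
    obtain F where F: "finite F" "F \<subseteq> (\<Union>k. U k)"
      "\<And>F'. finite F' \<Longrightarrow> F \<subseteq> F' \<Longrightarrow> F' \<subseteq> (\<Union>k. U k) \<Longrightarrow> dist (sum g F') S < e / 2"
      unfolding eventually_finite_subsets_at_top by metis
    obtain k0 where k0: "F \<subseteq> U k0"
    proof -
      obtain h where h: "\<And>x. x \<in> F \<Longrightarrow> x \<in> U (h x)"
        using F(2) by (metis UN_iff subset_iff)
      have "x \<in> U (Max (h ` F))" if "x \<in> F" for x
        using h[OF that] incseqD[OF U, of "h x" "Max (h ` F)"] F(1) that by auto
      then show thesis using that by blast
    qed
    have "dist (s k) S < e" if "k \<ge> k0" for k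
    proof -
      have "F \<subseteq> U k" using k0 incseqD[OF U that] by blast
      have "\<forall>\<^sub>F F' in finite_subsets_at_top (U k). dist (sum g F') S \<le> e / 2"
        unfolding eventually_finite_subsets_at_top
      proof (intro exI[of _ F] conjI allI impI)
        fix F' assume "finite F' \<and> F \<subseteq> F' \<and> F' \<subseteq> U k"
        then show "dist (sum g F') S \<le> e / 2" using F(3)[of F'] by fastforce
      qed (use F(1) \<open>F \<subseteq> U k\<close> in auto)
      moreover have "((\<lambda>F'. dist (sum g F') S) \<longlongrightarrow> dist (s k) S) (finite_subsets_at_top (U k))"
        by (intro tendsto_intros part[of k, unfolded has_sum_def])
      ultimately have "dist (s k) S \<le> e / 2"
        by (intro tendsto_upperbound[of "\<lambda>F'. dist (sum g F') S"]) auto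
      then show ?thesis using \<open>e > 0\<close> by simp
    qed
    then show "\<forall>\<^sub>F k in sequentially. dist (s k) S < e"
      unfolding eventually_sequentially by blast
  qed
  then show ?thesis using lim by (rule LIMSEQ_unique)
qed

text \<open>A multiset is its multiplicity at \<open>a\<close> together with the rest. This drives
  the inductions on the set of allowed parts.\<close>

lemma bij_betw_insert_part:
  assumes "a \<notin> A"
  shows "bij_betw (\<lambda>(m, N). replicate_mset m a + N) (UNIV \<times> {N. set_mset N \<subseteq> A})
           {M. set_mset M \<subseteq> insert a A}"
proof (rule bij_betw_byWitness[where f' = "\<lambda>M. (count M a, filter_mset (\<lambda>b. b \<noteq> a) M)"])
  show "\<forall>p\<in>UNIV \<times> {N. set_mset N \<subseteq> A}.
      (case case p of (m, N) \<Rightarrow> replicate_mset m a + N of M \<Rightarrow> (count M a, filter_mset (\<lambda>b. b \<noteq> a) M)) = p"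
  proof (clarsimp, intro conjI)
    fix m and N :: "'a multiset" assume "set_mset N \<subseteq> A"
    then have "a \<notin># N" using assms by auto
    then show "count N a = 0" "filter_mset (\<lambda>b. b \<noteq> a) (replicate_mset m a) + filter_mset (\<lambda>b. b \<noteq> a) N = N"
      by (auto simp: not_in_iff intro!: multiset_eqI)
  qed
next
  show "\<forall>M\<in>{M. set_mset M \<subseteq> insert a A}.
      (case (count M a, filter_mset (\<lambda>b. b \<noteq> a) M) of (m, N) \<Rightarrow> replicate_mset m a + N) = M"
    by (auto intro!: multiset_eqI)
qed (auto split: if_splits)

text \<open>The constant \<open>c\<close> is a parameter because removing the copies of one part
  moves their share of the sum of \<open>f\<close> into it.\<close>

definition mset_weight :: "('i \<Rightarrow> 'a) \<Rightarrow> ('i \<Rightarrow> 'a) \<Rightarrow> 'a \<Rightarrow> 'i multiset \<Rightarrow> 'a::comm_semiring_1" where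
  "mset_weight w f c M = (\<Prod>i\<in>#M. w i) * ((\<Sum>i\<in>#M. f i) + c)"

lemma mset_weight_replicate_add:
  "mset_weight w f c (replicate_mset m a + N) = w a ^ m * mset_weight w f (of_nat m * f a + c) N"
  by (simp add: mset_weight_def algebra_simps)

text \<open>The expected sum of \<open>mset_weight\<close> over multisets with parts in
  \<open>A\<close>: the product of the geometric series, times the mean of the additive factor. Here
  \<open>w i / (1 - w i)\<close> is the mean multiplicity of \<open>i\<close>.\<close>

definition weight_total :: "('i \<Rightarrow> 'a) \<Rightarrow> ('i \<Rightarrow> 'a) \<Rightarrow> 'a \<Rightarrow> 'i set \<Rightarrow> 'a::field" where
  "weight_total w f c A = (\<Prod>i\<in>A. 1 / (1 - w i)) * ((\<Sum>i\<in>A. f i * w i / (1 - w i)) + c)"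

text \<open>The summand depends on \<open>m\<close> only through \<open>w a ^ m\<close> and
  \<open>m * w a ^ m\<close>, so the geometric series and its derivative suffice.\<close>

lemma weight_total_insert_has_sum:
  fixes w f :: "'i \<Rightarrow> 'a :: {real_normed_field, banach}"
  assumes "norm (w a) < 1" "finite A" "a \<notin> A"
  shows "((\<lambda>m. w a ^ m * weight_total w f (of_nat m * f a + c) A)
            has_sum weight_total w f c (insert a A)) UNIV"
proof -
  define P where "P = (\<Prod>i\<in>A. 1 / (1 - w i))"
  define S where "S = (\<Sum>i\<in>A. f i * w i / (1 - w i))"
  have nz: "1 - w a \<noteq> 0" using assms(1) by force
  have g0: "((\<lambda>m. w a ^ m) has_sum 1 / (1 - w a)) UNIV"
    using assms(1) by (intro norm_summable_imp_has_sum geometric_sums) (simp_all add: norm_power)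
  have "((\<lambda>m. of_nat (Suc m) * w a ^ m) has_sum 1 / (1 - w a)\<^sup>2) UNIV"
  proof (rule norm_summable_imp_has_sum)
    have "(\<lambda>m. of_nat (Suc m) * norm (w a) ^ m) sums (1 / (1 - norm (w a))\<^sup>2)"
      using assms(1) by (intro geometric_deriv_sums) simp
    then show "summable (\<lambda>m. norm (of_nat (Suc m) * w a ^ m))"
      by (simp add: norm_mult norm_power sums_iff del: of_nat_Suc)
  qed (rule geometric_deriv_sums[OF assms(1)])
  \<comment> \<open>Writing \<open>m\<close> as \<open>Suc m - 1\<close> fits the derivative series
    and produces the correction \<open>- f a\<close>.\<close>
  then have "((\<lambda>m. of_nat (Suc m) * w a ^ m * (P * f a) + w a ^ m * (P * (S + c - f a)))
      has_sum (1 / (1 - w a)\<^sup>2 * (P * f a) + 1 / (1 - w a) * (P * (S + c - f a)))) UNIV"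
    by (intro has_sum_add has_sum_cmult_left g0)
  moreover have "1 / (1 - w a)\<^sup>2 * (P * f a) + 1 / (1 - w a) * (P * (S + c - f a)) =
      weight_total w f c (insert a A)"
    using assms(2,3) nz
    by (simp add: weight_total_def P_def[symmetric] S_def[symmetric] divide_simps power2_eq_square)
       algebra
  ultimately show ?thesis
    by (simp add: weight_total_def P_def[symmetric] S_def[symmetric] algebra_simps)
qed

text \<open>Sum over the rest \<open>N\<close> first, then over the multiplicity \<open>m\<close>.
  The induction hypothesis must cover every constant, since \<open>m\<close> copies of
  \<open>a\<close> shift it to \<open>of_nat m * f a + c\<close>. Summability is assumed because
  signed iterated sums do not imply it.\<close>

lemma weight_total_insert_step:
  fixes w f :: "'i \<Rightarrow> 'a :: {real_normed_field, banach}"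
  assumes "norm (w a) < 1" "finite A" "a \<notin> A"
    and IH: "\<And>c. (mset_weight w f c has_sum weight_total w f c A) {M. set_mset M \<subseteq> A}"
    and summable: "mset_weight w f c summable_on {M. set_mset M \<subseteq> insert a A}"
  shows "(mset_weight w f c has_sum weight_total w f c (insert a A)) {M. set_mset M \<subseteq> insert a A}"
proof -
  let ?h = "\<lambda>(m, N). replicate_mset m a + N"
  note bij = bij_betw_insert_part[OF assms(3)]
  have "((\<lambda>p. mset_weight w f c (?h p)) has_sum weight_total w f c (insert a A))
      (UNIV \<times> {N. set_mset N \<subseteq> A})"
  proof (rule has_sum_SigmaI[OF _ weight_total_insert_has_sum[where w = w and f = f, OF assms(1-3)]])
    show "((\<lambda>N. mset_weight w f c (?h (m, N))) has_sum
        w a ^ m * weight_total w f (of_nat m * f a + c) A) {N. set_mset N \<subseteq> A}" for m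
      by (simp add: mset_weight_replicate_add has_sum_cmult_right[OF IH])
    show "(\<lambda>p. mset_weight w f c (?h p)) summable_on UNIV \<times> {N. set_mset N \<subseteq> A}"
      using summable by (subst summable_on_reindex_bij_betw[OF bij])
  qed
  then show ?thesis
    by (subst (asm) has_sum_reindex_bij_betw[OF bij])
qed

lemma prod_mset_image_nonneg:
  fixes w :: "'i \<Rightarrow> real"
  assumes "\<And>i. w i \<ge> 0"
  shows "(\<Prod>i\<in>#M. w i) \<ge> 0"
  by (induction M) (use assms in auto)

lemma sum_mset_image_nonneg:
  fixes f :: "'i \<Rightarrow> real"
  assumes "\<And>i. f i \<ge> 0"
  shows "(\<Sum>i\<in>#M. f i) \<ge> 0"
  by (induction M) (use assms in auto)

lemma mset_weight_nonneg:
  fixes w f :: "'i \<Rightarrow> real"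
  assumes "\<And>i. w i \<ge> 0" "\<And>i. f i \<ge> 0" "c \<ge> 0"
  shows "mset_weight w f c M \<ge> 0"
  unfolding mset_weight_def using assms
  by (intro mult_nonneg_nonneg add_nonneg_nonneg prod_mset_image_nonneg sum_mset_image_nonneg) auto

text \<open>For nonnegative terms convergence of the iterated sum does give summability. This case
  supplies the majorant for the general one.\<close>

lemma mset_weight_has_sum_nonneg:
  fixes w f :: "'i \<Rightarrow> real"
  assumes "finite A" and w: "\<And>i. w i \<ge> 0" "\<And>i. i \<in> A \<Longrightarrow> w i < 1"
    and f: "\<And>i. f i \<ge> 0" and c: "c \<ge> 0"
  shows "(mset_weight w f c has_sum weight_total w f c A) {M. set_mset M \<subseteq> A}"
  using assms(1) w(2) c
proof (induction A arbitrary: c rule: finite_induct)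
  case empty
  then show ?case by (simp add: mset_weight_def weight_total_def has_sum_finiteI)
next
  case (insert a A)
  let ?h = "\<lambda>(m, N). replicate_mset m a + N"
  note bij = bij_betw_insert_part[OF insert.hyps(2)]
  have lt: "norm (w a) < 1" using insert.prems(1) w(1)[of a] by simp
  have IH: "(mset_weight w f c' has_sum weight_total w f c' A) {M. set_mset M \<subseteq> A}" if "c' \<ge> 0" for c'
    using insert.IH insert.prems(1) that by blast
  have inner: "((\<lambda>N. mset_weight w f c (?h (m, N))) has_sum
        w a ^ m * weight_total w f (of_nat m * f a + c) A) {N. set_mset N \<subseteq> A}" for m
    using f[of a] insert.prems(2)
    by (simp add: mset_weight_replicate_add has_sum_cmult_right[OF IH])
  note outer = weight_total_insert_has_sum[where w = w and f = f, OF lt insert.hyps(1,2)]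
  have "(\<lambda>p. mset_weight w f c (?h p)) summable_on UNIV \<times> {N. set_mset N \<subseteq> A}"
    by (rule summable_on_SigmaI[OF inner has_sum_imp_summable[OF outer]])
       (use w(1) f insert.prems(2) in \<open>auto intro!: mset_weight_nonneg\<close>)
  then have "((\<lambda>p. mset_weight w f c (?h p)) has_sum weight_total w f c (insert a A))
      (UNIV \<times> {N. set_mset N \<subseteq> A})"
    by (rule has_sum_SigmaI[OF inner outer])
  then show ?case
    by (subst (asm) has_sum_reindex_bij_betw[OF bij])
qed

lemma norm_mset_weight_le:
  fixes w f :: "'i \<Rightarrow> 'a :: real_normed_field"
  shows "norm (mset_weight w f c M) \<le> mset_weight (\<lambda>i. norm (w i)) (\<lambda>i. norm (f i)) (norm c) M"
proof -
  have "norm (\<Prod>i\<in>#M. w i) = (\<Prod>i\<in>#M. norm (w i))"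
    by (induction M) (simp_all add: norm_mult)
  moreover have "norm (\<Sum>i\<in>#M. f i) \<le> (\<Sum>i\<in>#M. norm (f i))"
  proof (induction M)
    case (add i M)
    then show ?case using norm_triangle_ineq[of "f i" "\<Sum>i\<in>#M. f i"] by simp
  qed simp
  then have "norm ((\<Sum>i\<in>#M. f i) + c) \<le> (\<Sum>i\<in>#M. norm (f i)) + norm c"
    by norm
  moreover have "0 \<le> (\<Prod>i\<in>#M. norm (w i))" by (intro prod_mset_image_nonneg) auto
  ultimately show ?thesis
    unfolding mset_weight_def norm_mult by (auto intro!: mult_left_mono)
qed

lemma mset_weight_abs_summable:
  fixes w f :: "'i \<Rightarrow> 'a :: real_normed_field"
  assumes "finite A" and w: "\<And>i. i \<in> A \<Longrightarrow> norm (w i) < 1"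
  shows "(\<lambda>M. norm (mset_weight w f c M)) summable_on {M. set_mset M \<subseteq> A}"
proof (rule summable_on_comparison_test)
  show "mset_weight (\<lambda>i. norm (w i)) (\<lambda>i. norm (f i)) (norm c) summable_on {M. set_mset M \<subseteq> A}"
    by (rule has_sum_imp_summable[OF mset_weight_has_sum_nonneg]) (use assms in auto)
qed (auto intro: norm_mset_weight_le)

lemma mset_weight_has_sum:
  fixes w f :: "'i \<Rightarrow> 'a :: {real_normed_field, banach}"
  assumes "finite A" and "\<And>i. i \<in> A \<Longrightarrow> norm (w i) < 1"
  shows "(mset_weight w f c has_sum weight_total w f c A) {M. set_mset M \<subseteq> A}"
  using assms
proof (induction A arbitrary: c rule: finite_induct)
  case empty
  then show ?case by (simp add: mset_weight_def weight_total_def has_sum_finiteI)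
next
  case (insert a A)
  then show ?case
    by (intro weight_total_insert_step abs_summable_summable[OF mset_weight_abs_summable]) auto
qed

text \<open>The uniform bound on the totals of absolute values gives summability over all multisets;
  the limit of the totals over \<open>{..<k}\<close> then identifies the sum.\<close>

lemma mset_weight_has_sum_lim:
  fixes w f :: "nat \<Rightarrow> 'a :: {real_normed_field, banach}"
  assumes w: "\<And>i. norm (w i) < 1"
    and lim: "(\<lambda>k. weight_total w f c {..<k}) \<longlonglongrightarrow> S"
    and bdd: "\<And>k. weight_total (\<lambda>i. norm (w i)) (\<lambda>i. norm (f i)) (norm c) {..<k} \<le> B"
  shows "(mset_weight w f c has_sum S) UNIV"
proof -
  define U where "U k = {M :: nat multiset. set_mset M \<subseteq> {..<k}}" for k
  have U: "incseq U" by (auto simp: U_def incseq_def)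
  have U_cover: "(\<Union>k. U k) = UNIV"
  proof -
    have "M \<in> U (Suc (Max (insert 0 (set_mset M))))" for M
      by (auto simp: U_def less_Suc_eq_le)
    then show ?thesis by blast
  qed
  have "mset_weight (\<lambda>i. norm (w i)) (\<lambda>i. norm (f i)) (norm c) summable_on UNIV"
  proof (rule nonneg_bdd_above_summable_on)
    show "bdd_above (sum (mset_weight (\<lambda>i. norm (w i)) (\<lambda>i. norm (f i)) (norm c)) `
        {F. F \<subseteq> UNIV \<and> finite F})"
    proof (rule bdd_aboveI2[where M = B])
      fix F :: "nat multiset set" assume "F \<in> {F. F \<subseteq> UNIV \<and> finite F}"
      then have F: "finite F" by simp
      \<comment> \<open>\<open>k\<close> exceeds every part of every multiset in \<open>F\<close>;
        inserting \<open>0\<close> keeps \<open>Max\<close> meaningful when there are no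
        parts.\<close>
      define k where "k = Suc (Max (insert 0 (\<Union>M\<in>F. set_mset M)))"
      have "F \<subseteq> U k"
        using F by (auto simp: U_def k_def less_Suc_eq_le intro!: Max_ge)
      moreover have "(mset_weight (\<lambda>i. norm (w i)) (\<lambda>i. norm (f i)) (norm c) has_sum
          weight_total (\<lambda>i. norm (w i)) (\<lambda>i. norm (f i)) (norm c) {..<k}) (U k)"
        unfolding U_def by (rule mset_weight_has_sum_nonneg) (use w in auto)
      ultimately have "sum (mset_weight (\<lambda>i. norm (w i)) (\<lambda>i. norm (f i)) (norm c)) F \<le>
          weight_total (\<lambda>i. norm (w i)) (\<lambda>i. norm (f i)) (norm c) {..<k}"
        using F by (intro has_sum_mono_neutral[OF has_sum_finite])
                   (auto intro!: mset_weight_nonneg)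
      then show "sum (mset_weight (\<lambda>i. norm (w i)) (\<lambda>i. norm (f i)) (norm c)) F \<le> B"
        using bdd[of k] by linarith
    qed
  qed (auto intro!: mset_weight_nonneg)
  then have "(\<lambda>M. norm (mset_weight w f c M)) summable_on UNIV"
    by (rule summable_on_comparison_test) (rule norm_mset_weight_le norm_ge_zero)+
  then have "mset_weight w f c summable_on UNIV"
    by (rule abs_summable_summable)
  then obtain T where T: "(mset_weight w f c has_sum T) UNIV"
    by (auto simp: summable_on_def)
  moreover have "T = S"
  proof (rule has_sum_incseq_unique[OF _ U _ lim])
    show "(mset_weight w f c has_sum T) (\<Union>k. U k)"
      using T by (simp only: U_cover)
    show "(mset_weight w f c has_sum weight_total w f c {..<k}) (U k)" for k
      unfolding U_def by (rule mset_weight_has_sum) (use w in auto)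
  qed
  ultimately show ?thesis by simp
qed

subsection \<open>A case of Jackson's transformation\<close>

lemma qpoch_0 [simp]: "qpoch q a 0 = 1"
  by (simp add: qpoch_def)

lemma qpoch_Suc: "qpoch q a (Suc n) = qpoch q a n * (1 - a * q ^ n)"
  by (simp add: qpoch_def)

lemma qpoch_add: "qpoch q a (m + n) = qpoch q a m * qpoch q (a * q ^ m) n"
  by (induction n) (simp_all add: qpoch_Suc power_add mult_ac)

lemma norm_power_mult_less_1:
  fixes a q :: complex
  assumes "norm q < 1" "norm a < 1"
  shows "norm (a * q ^ n) < 1"
  using assms mult_left_le[of "norm q ^ n" "norm a"]
  by (simp add: norm_mult norm_power power_le_one le_less_trans)

lemma one_minus_nonzero:
  fixes a q :: complex
  assumes "norm q < 1" "norm a < 1"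
  shows "1 - a * q ^ n \<noteq> 0"
  using norm_power_mult_less_1[OF assms, of n] by force

lemma qpoch_nonzero:
  assumes "norm q < 1" "norm a < 1"
  shows "qpoch q a n \<noteq> 0"
  using one_minus_nonzero[OF assms] by (simp add: qpoch_def)

lemma convergent_prod_qpoch:
  fixes q a :: complex
  assumes "norm q < 1"
  shows "convergent_prod (\<lambda>i. 1 - a * q ^ i)"
proof -
  have "summable (\<lambda>i. norm (- (a * q ^ i)))"
    using assms by (simp add: norm_mult norm_power summable_mult)
  then have "abs_convergent_prod (\<lambda>i. 1 + - (a * q ^ i))"
    by (subst abs_convergent_prod_conv_summable) simp
  then show ?thesis
    using abs_convergent_prod_imp_convergent_prod by simp
qed

lemma qpoch_LIMSEQ:
  assumes "norm q < 1"
  shows "qpoch q a \<longlonglongrightarrow> qpoch_inf q a"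
proof -
  have "(\<lambda>n. qpoch q a (Suc n)) \<longlonglongrightarrow> qpoch_inf q a"
    using convergent_prod_LIMSEQ[OF convergent_prod_qpoch[OF assms]]
    by (simp add: qpoch_def qpoch_inf_def lessThan_Suc_atMost)
  then show ?thesis
    by (simp only: filterlim_sequentially_Suc)
qed

lemma qpoch_inf_split:
  assumes "norm q < 1"
  shows "qpoch_inf q a = qpoch q a n * qpoch_inf q (a * q ^ n)"
proof (rule LIMSEQ_unique)
  show "(\<lambda>k. qpoch q a (k + n)) \<longlonglongrightarrow> qpoch_inf q a"
    using qpoch_LIMSEQ[OF assms] by (rule LIMSEQ_ignore_initial_segment)
  show "(\<lambda>k. qpoch q a (k + n)) \<longlonglongrightarrow> qpoch q a n * qpoch_inf q (a * q ^ n)"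
    unfolding add.commute[of _ n] qpoch_add
    by (intro tendsto_mult_left qpoch_LIMSEQ assms)
qed

lemma qpoch_inf_rec:
  assumes "norm q < 1"
  shows "qpoch_inf q a = (1 - a) * qpoch_inf q (a * q)"
  using qpoch_inf_split[OF assms, of a 1] by (simp add: qpoch_def)

lemma qpoch_inf_nonzero:
  fixes q a :: complex
  assumes "norm q < 1" "norm a < 1"
  shows "qpoch_inf q a \<noteq> 0"
  unfolding qpoch_inf_def
  by (intro prodinf_nonzero convergent_prod_qpoch one_minus_nonzero assms)

text \<open>These are the tails of a convergent product with nonzero value, that is, the value
  divided by the partial products.\<close>

lemma qpoch_inf_shift_tendsto_1:
  assumes "norm q < 1" "norm a < 1"
  shows "(\<lambda>n. qpoch_inf q (a * q ^ n)) \<longlonglongrightarrow> 1"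
proof -
  have "(\<lambda>n. qpoch_inf q a / qpoch q a n) \<longlonglongrightarrow> qpoch_inf q a / qpoch_inf q a"
    by (intro tendsto_divide tendsto_const qpoch_LIMSEQ qpoch_inf_nonzero assms)
  moreover have "qpoch_inf q a / qpoch q a n = qpoch_inf q (a * q ^ n)" for n
    using qpoch_inf_split[of q a n] qpoch_nonzero[of q a n] assms by simp
  ultimately show ?thesis
    using qpoch_inf_nonzero[OF assms] by simp
qed

text \<open>Each factor has norm at most \<open>1 + norm q ^ i\<close>, hence at most
  \<open>exp (norm q ^ i)\<close>, and the exponents form a geometric series. The bound is uniform
  in \<open>a\<close> and \<open>n\<close>.\<close>

lemma norm_qpoch_le:
  assumes "norm q < 1" "norm a \<le> 1"
  shows "norm (qpoch q a n) \<le> exp (1 / (1 - norm q))"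
proof -
  have "norm (qpoch q a n) \<le> (\<Prod>i<n. exp (norm q ^ i))"
    unfolding qpoch_def prod_norm[symmetric]
  proof (rule prod_mono, safe)
    fix i
    have "norm (1 - a * q ^ i) \<le> 1 + norm a * norm q ^ i"
      using norm_triangle_ineq4[of 1 "a * q ^ i"] by (simp add: norm_mult norm_power)
    also have "\<dots> \<le> 1 + norm q ^ i"
      using assms(2) by (simp add: mult_left_le_one_le)
    also have "\<dots> \<le> exp (norm q ^ i)"
      by (rule exp_ge_add_one_self)
    finally show "norm (1 - a * q ^ i) \<le> exp (norm q ^ i)" .
  qed simp
  also have "\<dots> = exp (\<Sum>i<n. norm q ^ i)"
    by (simp add: exp_sum)
  also have "(\<Sum>i<n. norm q ^ i) \<le> (\<Sum>i. norm q ^ i)"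
    using assms(1) by (intro sum_le_suminf summable_geometric) auto
  also have "\<dots> = 1 / (1 - norm q)"
    using assms(1) by (simp add: suminf_geometric)
  finally show ?thesis by simp
qed

lemma norm_qpoch_inf_le:
  assumes "norm q < 1" "norm a \<le> 1"
  shows "norm (qpoch_inf q a) \<le> exp (1 / (1 - norm q))"
  by (rule tendsto_upperbound[OF tendsto_norm[OF qpoch_LIMSEQ[OF assms(1)]]])
     (use norm_qpoch_le[OF assms] in auto)

section \<open>Dominated series and bounded solutions of \<open>q\<close>-difference
  equations\<close>

lemma summable_mult_bounded:
  fixes d s :: "nat \<Rightarrow> complex"
  assumes "summable (\<lambda>n. norm (d n))" "\<And>n. norm (s n) \<le> B"
  shows "summable (\<lambda>n. d n * s n)"
proof (rule summable_comparison_test'[of "\<lambda>n. norm (d n) * B" 0])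
  show "summable (\<lambda>n. norm (d n) * B)"
    using assms(1) by (rule summable_mult2)
  show "norm (d n * s n) \<le> norm (d n) * B" for n
    using assms(2)[of n] by (simp add: norm_mult mult_left_mono)
qed

lemma norm_suminf_mult_bounded:
  fixes d s :: "nat \<Rightarrow> complex"
  assumes "summable (\<lambda>n. norm (d n))" "\<And>n. norm (s n) \<le> B"
  shows "norm (\<Sum>n. d n * s n) \<le> (\<Sum>n. norm (d n)) * B"
  unfolding suminf_mult2[OF assms(1)]
  by (rule norm_suminf_le)
     (use assms in \<open>auto simp: norm_mult intro!: mult_left_mono summable_mult2\<close>)

text \<open>Iteration gives \<open>u 0\<close> as \<open>c ^ n\<close> times a bounded quantity. The
  coefficient is split into \<open>c\<close> and \<open>r n\<close> because single factors
  \<open>r n\<close> may exceed 1 in norm; only their products need a bound.\<close>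

lemma zero_if_contracting:
  fixes u r :: "nat \<Rightarrow> complex"
  assumes "\<And>n. u n = c * r n * u (Suc n)"
    and "\<And>n. norm (\<Prod>i<n. r i) \<le> A" and "\<And>n. norm (u n) \<le> B" and "norm c < 1"
  shows "u 0 = 0"
proof -
  have iter: "u 0 = c ^ n * (\<Prod>i<n. r i) * u n" for n
  proof (induction n)
    case (Suc n)
    then show ?case using assms(1)[of n] by (simp add: mult_ac)
  qed simp
  have "norm (u 0) \<le> norm c ^ n * (A * B)" for n
  proof -
    have "norm (u 0) = norm c ^ n * (norm (\<Prod>i<n. r i) * norm (u n))"
      by (subst iter[of n]) (simp add: norm_mult norm_power mult_ac)
    also have "\<dots> \<le> norm c ^ n * (A * B)"
      using order_trans[OF norm_ge_zero assms(2)[of n]]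
      by (intro mult_left_mono mult_mono assms) auto
    finally show ?thesis .
  qed
  moreover have "(\<lambda>n. norm c ^ n * (A * B)) \<longlonglongrightarrow> 0"
    using assms(4) by (intro tendsto_mult_left_zero LIMSEQ_power_zero) simp
  ultimately have "norm (u 0) \<le> 0"
    by (intro tendsto_lowerbound[of "\<lambda>n. norm c ^ n * (A * B)"]) auto
  then show ?thesis by simp
qed

section \<open>Coefficients shared by the hypergeometric series\<close>

text \<open>The part of the coefficients of \<open>1Phi1\<close> and \<open>2Phi2\<close> that
  remains once the denominators depending on the argument are cleared; in both series the sign and
  triangular power occur with exponent 1.\<close>

definition qcoeff :: "complex \<Rightarrow> complex \<Rightarrow> nat \<Rightarrow> complex" where
  "qcoeff q a n = qpoch q a n * ((-1) ^ n * q ^ (n * (n - 1) div 2)) / qpoch q q n"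

lemma triangular_exponent_Suc: "Suc n * (Suc n - 1) div 2 = n * (n - 1) div 2 + n"
  by (induction n) auto

lemma qcoeff_0 [simp]: "qcoeff q a 0 = 1"
  by (simp add: qcoeff_def)

lemma qcoeff_Suc:
  assumes "norm q < 1"
  shows "qcoeff q a (Suc n) * (1 - q ^ Suc n) = - (qcoeff q a n * (1 - a * q ^ n) * q ^ n)"
proof -
  define T where "T = (-1) ^ n * q ^ (n * (n - 1) div 2)"
  have "1 - q * q ^ n \<noteq> 0" "qpoch q q n \<noteq> 0"
    using one_minus_nonzero[OF assms assms] qpoch_nonzero[OF assms assms] by auto
  moreover have "(-1) ^ Suc n * q ^ (Suc n * (Suc n - 1) div 2) = - (T * q ^ n)"
    unfolding triangular_exponent_Suc T_def power_add by simp
  ultimately show ?thesis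
    unfolding qcoeff_def T_def[symmetric] by (simp add: qpoch_Suc divide_simps)
qed

text \<open>The ratio of consecutive coefficients carries a factor \<open>q ^ n\<close> and tends to
  0. The series below therefore converge as soon as their remaining factors are bounded.\<close>

lemma summable_qcoeff:
  assumes q: "norm q < 1"
  shows "summable (\<lambda>n. norm (qcoeff q a n))"
proof -
  have "(\<lambda>n. (1 - a * q ^ n) * q ^ n / (1 - q ^ Suc n)) \<longlonglongrightarrow> (1 - a * 0) * 0 / (1 - 0)"
    by (intro tendsto_intros LIMSEQ_power_zero[OF q] LIMSEQ_Suc[OF LIMSEQ_power_zero[OF q]]) simp
  then have "\<forall>\<^sub>F n in sequentially. norm ((1 - a * q ^ n) * q ^ n / (1 - q ^ Suc n)) < 1 / 2"
    using tendsto_norm order_tendstoD(2)[of _ 0 sequentially "1 / 2 :: real"] by fastforce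
  then obtain N where N: "\<And>n. n \<ge> N \<Longrightarrow> norm ((1 - a * q ^ n) * q ^ n / (1 - q ^ Suc n)) < 1 / 2"
    unfolding eventually_sequentially by blast
  show ?thesis
  proof (rule summable_ratio_test[of "1 / 2" N])
    fix n assume "n \<ge> N"
    have "qcoeff q a (Suc n) = - ((1 - a * q ^ n) * q ^ n / (1 - q ^ Suc n)) * qcoeff q a n"
      using qcoeff_Suc[OF q, of a n] one_minus_nonzero[OF q q, of n] by (simp add: field_simps)
    then have "norm (qcoeff q a (Suc n)) =
        norm ((1 - a * q ^ n) * q ^ n / (1 - q ^ Suc n)) * norm (qcoeff q a n)"
      by (metis norm_minus_cancel norm_mult)
    also have "\<dots> \<le> 1 / 2 * norm (qcoeff q a n)"
      using N[OF \<open>n \<ge> N\<close>] by (intro mult_right_mono) auto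
    finally show "norm (norm (qcoeff q a (Suc n))) \<le> 1 / 2 * norm (norm (qcoeff q a n))" by simp
  qed simp
qed

section \<open>The \<open>1Phi1\<close> summation\<close>

context
  fixes q a :: complex
  assumes q: "norm q < 1" and a: "norm a < 1"
begin

lemma norm_arg_le:
  assumes "norm w \<le> 1"
  shows "norm (a * w * q ^ n) \<le> 1"
proof -
  have "norm (a * w * q ^ n) = norm a * (norm w * norm q ^ n)"
    by (simp add: norm_mult norm_power)
  also have "\<dots> \<le> 1 * (1 * 1)"
    using q a assms by (intro mult_mono power_le_one) auto
  finally show ?thesis by simp
qed

lemma norm_factor_le:
  assumes "norm w \<le> 1"
  shows "norm (w ^ k * qpoch_inf q (a * w * q ^ n)) \<le> exp (1 / (1 - norm q))"
proof -
  have "norm (w ^ k * qpoch_inf q (a * w * q ^ n)) \<le> 1 * exp (1 / (1 - norm q))"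
    unfolding norm_mult norm_power
    using assms norm_qpoch_inf_le[OF q norm_arg_le[OF assms]]
    by (intro mult_mono power_le_one) auto
  then show ?thesis by simp
qed

text \<open>The series \<open>qpoch_inf q (a * w) * qPhi q [a] [a * w] w\<close>, rewritten without denominators
  depending on \<open>w\<close>.\<close>

definition phi11 :: "complex \<Rightarrow> complex" where
  "phi11 w = (\<Sum>n. qcoeff q a n * (w ^ n * qpoch_inf q (a * w * q ^ n)))"

text \<open>The termwise form of \<open>phi11 w - (1 - w) * phi11 (w * q)\<close>, which must vanish
  for \<open>phi11\<close> to satisfy the recursion of \<open>qpoch_inf q w\<close>.\<close>

definition phi11_defect :: "complex \<Rightarrow> complex" where
  "phi11_defect w = (\<Sum>n. qcoeff q a n * (w ^ n * qpoch_inf q (a * w * q ^ Suc n) *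
               ((1 - q ^ n) + w * q ^ n * (1 - a))))"

lemma summable_phi11:
  assumes "norm w \<le> 1"
  shows "summable (\<lambda>n. qcoeff q a n * (w ^ n * qpoch_inf q (a * w * q ^ n)))"
  by (rule summable_mult_bounded[OF summable_qcoeff[OF q] norm_factor_le[OF assms]])

lemma qpoch_inf_arg_Suc:
  "qpoch_inf q (a * w * q ^ n) = (1 - a * w * q ^ n) * qpoch_inf q (a * w * q ^ Suc n)"
  using qpoch_inf_rec[OF q, of "a * w * q ^ n"] by (simp add: mult_ac)

lemma norm_mult_q_le:
  assumes "norm w \<le> 1"
  shows "norm (w * q) \<le> 1"
  using assms q by (simp add: norm_mult mult_le_one)

lemma norm_pow_le_1: "norm (q ^ n) \<le> 1"
  using q by (simp add: norm_power power_le_one)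

lemma phi11_defect_eq:
  assumes w: "norm w \<le> 1"
  shows "phi11_defect w = phi11 w - (1 - w) * phi11 (w * q)"
proof -
  note s = summable_phi11[OF w] summable_phi11[OF norm_mult_q_le[OF w]]
  have "phi11 w - (1 - w) * phi11 (w * q) = (\<Sum>n. qcoeff q a n * (w ^ n * qpoch_inf q (a * w * q ^ n)) -
      (1 - w) * (qcoeff q a n * ((w * q) ^ n * qpoch_inf q (a * (w * q) * q ^ n))))"
    unfolding phi11_def using s
    by (subst suminf_mult[symmetric], simp, subst suminf_diff) (auto intro!: summable_mult)
  also have "\<dots> = phi11_defect w"
    unfolding phi11_defect_def
    by (rule arg_cong[where f = suminf], rule ext, subst qpoch_inf_arg_Suc)
       (simp add: algebra_simps)
  finally show ?thesis by simp
qed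

text \<open>The bound is uniform on the closed unit disc, as the contraction argument requires. The
  4 is 2 from \<open>1 - q ^ n\<close> plus 2 from \<open>w * q ^ n * (1 - a)\<close>.\<close>

lemma norm_phi11_defect_le:
  assumes w: "norm w \<le> 1"
  shows "norm (phi11_defect w) \<le> (\<Sum>n. norm (qcoeff q a n)) * (exp (1 / (1 - norm q)) * 4)"
    and "summable (\<lambda>n. qcoeff q a n * (w ^ n * qpoch_inf q (a * w * q ^ Suc n) *
               ((1 - q ^ n) + w * q ^ n * (1 - a))))"
proof -
  have b: "norm (w ^ n * qpoch_inf q (a * w * q ^ Suc n) * ((1 - q ^ n) + w * q ^ n * (1 - a)))
      \<le> exp (1 / (1 - norm q)) * 4" for n
  proof -
    have "norm (1 - q ^ n) \<le> 2"
      using norm_triangle_ineq4[of 1 "q ^ n"] norm_pow_le_1[of n] by simp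
    moreover have "norm (1 - a) \<le> 2"
      using norm_triangle_ineq4[of 1 a] a by simp
    then have "norm w * norm (q ^ n) * norm (1 - a) \<le> 1 * 1 * 2"
      using w norm_pow_le_1[of n] by (intro mult_mono) auto
    ultimately have "norm ((1 - q ^ n) + w * q ^ n * (1 - a)) \<le> 4"
      using norm_triangle_ineq[of "1 - q ^ n" "w * q ^ n * (1 - a)"] by (simp add: norm_mult)
    then show ?thesis
      unfolding norm_mult[of "w ^ n * _"]
      by (intro mult_mono norm_factor_le w) auto
  qed
  show "norm (phi11_defect w) \<le> (\<Sum>n. norm (qcoeff q a n)) * (exp (1 / (1 - norm q)) * 4)"
    unfolding phi11_defect_def by (rule norm_suminf_mult_bounded[OF summable_qcoeff[OF q] b])
  show "summable (\<lambda>n. qcoeff q a n * (w ^ n * qpoch_inf q (a * w * q ^ Suc n) *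
               ((1 - q ^ n) + w * q ^ n * (1 - a))))"
    by (rule summable_mult_bounded[OF summable_qcoeff[OF q] b])
qed

text \<open>Shifting the part with factor \<open>1 - q ^ n\<close> by one index turns the summand at \<open>w\<close> into the
  summand at \<open>w * q\<close>.\<close>

lemma phi11_defect_rec:
  assumes w: "norm w \<le> 1"
  shows "phi11_defect w = a * (- w) * phi11_defect (w * q)"
proof -
  define f where "f n = qcoeff q a n * (w ^ n * qpoch_inf q (a * w * q ^ Suc n))" for n
  have q1: "norm (1 - q ^ n) \<le> 2" for n
    using norm_triangle_ineq4[of 1 "q ^ n"] norm_pow_le_1[of n] by simp
  have b1: "norm (w ^ n * qpoch_inf q (a * w * q ^ Suc n) * (1 - q ^ n))
        \<le> exp (1 / (1 - norm q)) * 2" for n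
    unfolding norm_mult[of "w ^ n * _"] by (intro mult_mono norm_factor_le w q1) auto
  have b2: "norm (w ^ n * qpoch_inf q (a * w * q ^ Suc n) * q ^ n)
        \<le> exp (1 / (1 - norm q)) * 1" for n
    unfolding norm_mult[of "w ^ n * _"] by (intro mult_mono norm_factor_le w norm_pow_le_1) auto
  have s1: "summable (\<lambda>n. f n * (1 - q ^ n))"
    using summable_mult_bounded[OF summable_qcoeff[OF q] b1] by (simp add: f_def mult_ac)
  have s2: "summable (\<lambda>n. f n * q ^ n * (w * (1 - a)))"
    using summable_mult2[OF summable_mult_bounded[OF summable_qcoeff[OF q] b2], where c = "w * (1 - a)"]
    by (simp add: f_def mult.assoc)
  have "phi11_defect w = (\<Sum>n. f n * (1 - q ^ n) + f n * q ^ n * (w * (1 - a)))"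
    unfolding phi11_defect_def f_def by (simp add: algebra_simps)
  also have "\<dots> = (\<Sum>n. f n * (1 - q ^ n)) + (\<Sum>n. f n * q ^ n * (w * (1 - a)))"
    using s1 s2 by (rule suminf_add[symmetric])
  \<comment> \<open>The term at \<open>n = 0\<close> vanishes because
    \<open>1 - q ^ 0 = 0\<close>.\<close>
  also have "(\<Sum>n. f n * (1 - q ^ n)) = (\<Sum>n. f (Suc n) * (1 - q ^ Suc n))"
    using suminf_split_head[OF s1] by simp
  also have "\<dots> + (\<Sum>n. f n * q ^ n * (w * (1 - a))) =
      (\<Sum>n. f (Suc n) * (1 - q ^ Suc n) + f n * q ^ n * (w * (1 - a)))"
    using s2 summable_ignore_initial_segment[OF s1, of 1]
    by (intro suminf_add) (simp_all del: power_Suc)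
  also have "\<dots> = (\<Sum>n. a * (- w) * (qcoeff q a n * ((w * q) ^ n *
      qpoch_inf q (a * (w * q) * q ^ Suc n) * ((1 - q ^ n) + w * q * q ^ n * (1 - a)))))"
  proof (rule arg_cong[where f = suminf], rule ext)
    fix n
    \<comment> \<open>All infinite products in the summands are multiples of \<open>e\<close>, so a
      polynomial identity remains.\<close>
    define e where "e = qpoch_inf q (a * w * q ^ Suc (Suc n))"
    have "f (Suc n) * (1 - q ^ Suc n) = (qcoeff q a (Suc n) * (1 - q ^ Suc n)) * w ^ Suc n * e"
      by (simp add: f_def e_def)
    also have "\<dots> = - (qcoeff q a n * (1 - a * q ^ n) * q ^ n) * w ^ Suc n * e"
      by (simp only: qcoeff_Suc[OF q])
    finally have 1: "f (Suc n) * (1 - q ^ Suc n) =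
        - (qcoeff q a n * (1 - a * q ^ n) * q ^ n) * w ^ Suc n * e" .
    have 2: "f n = qcoeff q a n * w ^ n * (1 - a * w * q ^ Suc n) * e"
      unfolding f_def e_def by (subst qpoch_inf_arg_Suc) simp
    have 3: "qpoch_inf q (a * (w * q) * q ^ Suc n) = e"
      by (simp add: e_def mult_ac)
    show "f (Suc n) * (1 - q ^ Suc n) + f n * q ^ n * (w * (1 - a)) =
        a * (- w) * (qcoeff q a n * ((w * q) ^ n *
      qpoch_inf q (a * (w * q) * q ^ Suc n) * ((1 - q ^ n) + w * q * q ^ n * (1 - a))))"
      unfolding 1 3 unfolding 2 by (simp add: power_mult_distrib) algebra
  qed
  also have "\<dots> = a * (- w) * phi11_defect (w * q)"
    unfolding phi11_defect_def by (rule suminf_mult[OF norm_phi11_defect_le(2)[OF norm_mult_q_le[OF w]]])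
  finally show ?thesis .
qed

lemma norm_orbit_le:
  assumes "norm w \<le> 1"
  shows "norm (w * q ^ n) \<le> 1"
  using assms norm_pow_le_1[of n] by (simp add: norm_mult mult_le_one)

text \<open>Each step along the orbit \<open>w * q ^ n\<close> gains a factor \<open>a\<close> of
  norm below 1, while the other factors \<open>- (w * q ^ n)\<close> stay in the unit disc.\<close>

lemma phi11_defect_zero:
  assumes w: "norm w \<le> 1"
  shows "phi11_defect w = 0"
proof -
  have "phi11_defect (w * q ^ 0) = 0"
  proof (rule zero_if_contracting[of "\<lambda>n. phi11_defect (w * q ^ n)" a "\<lambda>n. - (w * q ^ n)" 1])
    show "phi11_defect (w * q ^ n) = a * (- (w * q ^ n)) * phi11_defect (w * q ^ Suc n)" for n
      using phi11_defect_rec[OF norm_orbit_le[OF w], of n] by (simp add: mult_ac)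
    show "norm (\<Prod>i<n. - (w * q ^ i)) \<le> 1" for n
      unfolding prod_norm[symmetric] using norm_orbit_le[OF w] by (intro prod_le_1) auto
  qed (use norm_phi11_defect_le(1)[OF norm_orbit_le[OF w]] a in auto)
  then show ?thesis by simp
qed

lemma phi11_iter:
  assumes w: "norm w \<le> 1"
  shows "phi11 w = qpoch q w n * phi11 (w * q ^ n)"
proof (induction n)
  case (Suc n)
  have "phi11 (w * q ^ n) = (1 - w * q ^ n) * phi11 (w * q ^ Suc n)"
    using phi11_defect_eq[OF norm_orbit_le[OF w], of n] phi11_defect_zero[OF norm_orbit_le[OF w], of n]
    by (simp add: mult_ac)
  then show ?case using Suc by (simp add: qpoch_Suc)
qed simp

text \<open>The leading term is \<open>qpoch_inf q (a * w * q ^ n)\<close>, which tends to 1; the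
  rest is \<open>w * q ^ n\<close> times a bounded series.\<close>

lemma phi11_tendsto:
  assumes w: "norm w \<le> 1"
  shows "(\<lambda>n. phi11 (w * q ^ n)) \<longlonglongrightarrow> 1"
proof -
  define B where "B = (\<Sum>n. norm (qcoeff q a (Suc n))) * exp (1 / (1 - norm q))"
  define T where "T m = (\<Sum>n. qcoeff q a (Suc n) * ((w * q ^ m) ^ n *
                  qpoch_inf q (a * (w * q ^ m) * q ^ Suc n)))" for m
  have sq: "summable (\<lambda>n. norm (qcoeff q a (Suc n)))"
    using summable_qcoeff[OF q] by (subst summable_Suc_iff)
  have phi11: "phi11 (w * q ^ m) = (w * q ^ m) * T m + qpoch_inf q (a * w * q ^ m)" for m
  proof -
    have "phi11 (w * q ^ m) = (\<Sum>n. qcoeff q a (Suc n) * ((w * q ^ m) ^ Suc n *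
                  qpoch_inf q (a * (w * q ^ m) * q ^ Suc n))) + qpoch_inf q (a * w * q ^ m)"
      using suminf_split_head[OF summable_phi11[OF norm_orbit_le[OF w]], of m]
      by (simp add: phi11_def mult_ac)
    also have "(\<Sum>n. qcoeff q a (Suc n) * ((w * q ^ m) ^ Suc n *
                  qpoch_inf q (a * (w * q ^ m) * q ^ Suc n))) = (w * q ^ m) * T m"
      unfolding T_def
      by (subst suminf_mult[OF
            summable_mult_bounded[OF sq norm_factor_le[OF norm_orbit_le[OF w]]], symmetric])
         (simp add: mult_ac)
    finally show ?thesis .
  qed
  have "norm (T m) \<le> B" for m
    unfolding T_def B_def
    by (rule norm_suminf_mult_bounded[OF sq norm_factor_le[OF norm_orbit_le[OF w]]])
  then have "norm ((w * q ^ m) * T m) \<le> norm (w * q ^ m) * B" for m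
    by (simp add: norm_mult mult_left_mono)
  moreover have "(\<lambda>m. norm (w * q ^ m) * B) \<longlonglongrightarrow> 0"
    by (intro tendsto_mult_left_zero tendsto_norm_zero tendsto_mult_right_zero LIMSEQ_power_zero q)
  ultimately have "(\<lambda>m. (w * q ^ m) * T m) \<longlonglongrightarrow> 0"
    by (intro Lim_null_comparison[of "\<lambda>m. (w * q ^ m) * T m" "\<lambda>m. norm (w * q ^ m) * B"]) auto
  moreover have "norm (a * w) < 1"
    using a w mult_left_le[of "norm w" "norm a"] by (simp add: norm_mult)
  then have "(\<lambda>m. qpoch_inf q (a * w * q ^ m)) \<longlonglongrightarrow> 1"
    by (rule qpoch_inf_shift_tendsto_1[OF q])
  ultimately show ?thesis
    unfolding phi11 using tendsto_add by fastforce
qed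

text \<open>Let the number of iterations in \<open>phi11_iter\<close> tend to infinity.\<close>

lemma phi11_eq:
  assumes w: "norm w \<le> 1"
  shows "phi11 w = qpoch_inf q w"
proof (rule LIMSEQ_unique)
  show "(\<lambda>n. phi11 w) \<longlonglongrightarrow> phi11 w" by simp
  show "(\<lambda>n. phi11 w) \<longlonglongrightarrow> qpoch_inf q w"
    using tendsto_mult[OF qpoch_LIMSEQ[OF q, of w] phi11_tendsto[OF w]] phi11_iter[OF w] by simp
qed

section \<open>Lambert series and Jackson's transformation\<close>

definition lambert :: "complex \<Rightarrow> complex" where
  "lambert z = (\<Sum>n. z ^ n / (1 - a * q ^ n))"

text \<open>The right-hand side of Jackson's transformation times \<open>qpoch_inf q z\<close>, up to the
  factor \<open>1 - a\<close>.\<close>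

definition jackson_series :: "complex \<Rightarrow> complex" where
  "jackson_series z = (\<Sum>n. qcoeff q a n * ((z * q) ^ n * qpoch_inf q (a * z * q ^ n) / (1 - a * q ^ n)))"

lemma norm_denominator_ge: "1 - norm a \<le> norm (1 - a * q ^ n)"
proof -
  have "norm (a * q ^ n) \<le> norm a"
    using mult_left_le[OF norm_pow_le_1[of n], of "norm a"] by (simp add: norm_mult)
  then show ?thesis
    using norm_triangle_ineq2[of 1 "a * q ^ n"] by simp
qed

lemma norm_div_denominator_le: "norm (u / (1 - a * q ^ n)) \<le> norm u / (1 - norm a)"
  unfolding norm_divide using norm_denominator_ge[of n] a by (intro divide_left_mono mult_pos_pos) auto

lemma lambert_summable:
  assumes "norm z < 1"
  shows "summable (\<lambda>n. norm (z ^ n / (1 - a * q ^ n)))"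
proof (rule summable_comparison_test'[of "\<lambda>n. norm z ^ n / (1 - norm a)" 0])
  show "summable (\<lambda>n. norm z ^ n / (1 - norm a))"
    using assms by (intro summable_divide summable_geometric) simp
  show "norm (norm (z ^ n / (1 - a * q ^ n))) \<le> norm z ^ n / (1 - norm a)" for n
    using norm_div_denominator_le[of "z ^ n" n] by (simp add: norm_power)
qed

text \<open>One bound for the whole orbit \<open>z * q ^ n\<close>, whose points have norm at most
  \<open>norm z\<close>.\<close>

lemma norm_lambert_le:
  assumes z: "norm z < 1" and w: "norm w \<le> norm z"
  shows "norm (lambert w) \<le> (\<Sum>n. norm z ^ n / (1 - norm a))"
  unfolding lambert_def
proof (rule norm_suminf_le)
  show "summable (\<lambda>n. norm z ^ n / (1 - norm a))"
    using z by (intro summable_divide summable_geometric) simp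
  show "norm (w ^ n / (1 - a * q ^ n)) \<le> norm z ^ n / (1 - norm a)" for n
  proof -
    have "norm (w ^ n / (1 - a * q ^ n)) \<le> norm w ^ n / (1 - norm a)"
      using norm_div_denominator_le[of "w ^ n" n] by (simp add: norm_power)
    also have "\<dots> \<le> norm z ^ n / (1 - norm a)"
      using w a by (intro divide_right_mono power_mono) auto
    finally show ?thesis .
  qed
qed

text \<open>Subtracting \<open>a * lambert (z * q)\<close> multiplies the terms by
  \<open>1 - a * q ^ n\<close>, which cancels the denominators and leaves a geometric
  series.\<close>

lemma lambert_rec:
  assumes z: "norm z < 1"
  shows "lambert z = 1 / (1 - z) + a * lambert (z * q)"
proof -
  have zq: "norm (z * q) < 1"
    using norm_power_mult_less_1[OF q z, of 1] by simp
  note s = summable_norm_cancel[OF lambert_summable[OF z]]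
    summable_norm_cancel[OF lambert_summable[OF zq]]
  have "lambert z - a * lambert (z * q) =
      (\<Sum>n. z ^ n / (1 - a * q ^ n) - a * ((z * q) ^ n / (1 - a * q ^ n)))"
    unfolding lambert_def
    by (subst suminf_mult[OF s(2), symmetric], rule suminf_diff[OF s(1) summable_mult[OF s(2)]])
  also have "\<dots> = (\<Sum>n. z ^ n)"
  proof (rule arg_cong[where f = suminf], rule ext)
    fix n
    have "z ^ n / (1 - a * q ^ n) - a * ((z * q) ^ n / (1 - a * q ^ n)) =
        z ^ n * (1 - a * q ^ n) / (1 - a * q ^ n)"
      by (simp add: diff_divide_distrib algebra_simps)
    then show "z ^ n / (1 - a * q ^ n) - a * ((z * q) ^ n / (1 - a * q ^ n)) = z ^ n"
      using one_minus_nonzero[OF q a, of n] by simp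
  qed
  also have "\<dots> = 1 / (1 - z)"
    using z by (rule suminf_geometric)
  finally show ?thesis by (simp add: algebra_simps)
qed

lemma norm_jackson_series_term_le:
  assumes "norm z \<le> 1"
  shows "norm ((z * q) ^ n * qpoch_inf q (a * z * q ^ n) / (1 - a * q ^ n))
           \<le> exp (1 / (1 - norm q)) / (1 - norm a)"
proof -
  have "norm ((z * q) ^ n * qpoch_inf q (a * z * q ^ n))
      = norm q ^ n * norm (z ^ n * qpoch_inf q (a * z * q ^ n))"
    by (simp add: norm_mult norm_power power_mult_distrib)
  also have "\<dots> \<le> 1 * exp (1 / (1 - norm q))"
    using q by (intro mult_mono norm_factor_le assms power_le_one) auto
  finally have "norm ((z * q) ^ n * qpoch_inf q (a * z * q ^ n)) / (1 - norm a)
      \<le> exp (1 / (1 - norm q)) / (1 - norm a)"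
    using a by (intro divide_right_mono) auto
  then show ?thesis
    using norm_div_denominator_le order_trans by blast
qed

lemmas jackson_series_summable = summable_mult_bounded[OF summable_qcoeff[OF q] norm_jackson_series_term_le]

text \<open>As \<open>(1 - a * z * q ^ n) - a * (1 - z) * q ^ n = 1 - a * q ^ n\<close>, the
  denominators cancel termwise and leave \<open>phi11 (z * q)\<close>, which the
  \<open>1Phi1\<close> summation evaluates.\<close>

lemma jackson_series_rec:
  assumes z: "norm z \<le> 1"
  shows "jackson_series z = a * (1 - z) * jackson_series (z * q) + qpoch_inf q (z * q)"
proof -
  note s = jackson_series_summable[OF z] jackson_series_summable[OF norm_mult_q_le[OF z]]
  have "jackson_series z - a * (1 - z) * jackson_series (z * q) =
      (\<Sum>n. qcoeff q a n * ((z * q) ^ n * qpoch_inf q (a * z * q ^ n) / (1 - a * q ^ n)) -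
      a * (1 - z) * (qcoeff q a n *
        ((z * q * q) ^ n * qpoch_inf q (a * (z * q) * q ^ n) / (1 - a * q ^ n))))"
    unfolding jackson_series_def
    by (subst suminf_mult[OF s(2), symmetric], rule suminf_diff[OF s(1) summable_mult[OF s(2)]])
  also have "\<dots> = phi11 (z * q)"
    unfolding phi11_def
  proof (rule arg_cong[where f = suminf], rule ext)
    fix n
    define e where "e = qpoch_inf q (a * z * q ^ Suc n)"
    have 1: "qpoch_inf q (a * z * q ^ n) = (1 - a * z * q ^ n) * e"
      unfolding e_def by (rule qpoch_inf_arg_Suc)
    have 2: "qpoch_inf q (a * (z * q) * q ^ n) = e"
      by (simp add: e_def mult_ac)
    show "qcoeff q a n * ((z * q) ^ n * qpoch_inf q (a * z * q ^ n) / (1 - a * q ^ n)) -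
      a * (1 - z) * (qcoeff q a n *
        ((z * q * q) ^ n * qpoch_inf q (a * (z * q) * q ^ n) / (1 - a * q ^ n))) =
      qcoeff q a n * ((z * q) ^ n * qpoch_inf q (a * (z * q) * q ^ n))"
      unfolding 1 2 using one_minus_nonzero[OF q a, of n]
      by (simp add: divide_simps) algebra
  qed
  also have "\<dots> = qpoch_inf q (z * q)"
    by (rule phi11_eq[OF norm_mult_q_le[OF z]])
  finally show ?thesis by (simp add: algebra_simps)
qed

text \<open>Both sides satisfy the same inhomogeneous equation, so the difference \<open>D\<close>
  satisfies \<open>D w = a * (1 - w) * D (w * q)\<close> and is bounded along the orbit of
  \<open>z\<close>; the products of the factors \<open>1 - z * q ^ n\<close> are finite
  \<open>q\<close>-Pochhammer symbols.\<close>

lemma qpoch_inf_mult_lambert: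
  assumes z: "norm z < 1"
  shows "qpoch_inf q z * lambert z = jackson_series z"
proof -
  define D where "D w = qpoch_inf q w * lambert w - jackson_series w" for w
  have orbit: "norm (z * q ^ n) < 1" for n
    by (rule norm_power_mult_less_1[OF q z])
  have orbit_le: "norm (z * q ^ n) \<le> norm z" for n
    using mult_left_le[OF norm_pow_le_1[of n], of "norm z"] by (simp add: norm_mult)
  have "D (z * q ^ 0) = 0"
  proof (rule zero_if_contracting[of "\<lambda>n. D (z * q ^ n)" a "\<lambda>n. 1 - z * q ^ n"])
    show "D (z * q ^ n) = a * (1 - z * q ^ n) * D (z * q ^ Suc n)" for n
    proof -
      define w where "w = z * q ^ n"
      have w: "norm w < 1" using orbit by (simp add: w_def)
      have "1 - w \<noteq> 0" using w by force
      then have "D w = a * (1 - w) * D (w * q)"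
        unfolding D_def qpoch_inf_rec[OF q, of w] lambert_rec[OF w] jackson_series_rec[OF less_imp_le[OF w]]
        by (simp add: field_simps)
      then show ?thesis by (simp add: w_def mult_ac)
    qed
    show "norm (\<Prod>i<n. 1 - z * q ^ i) \<le> exp (1 / (1 - norm q))" for n
      using norm_qpoch_le[OF q less_imp_le[OF z], of n] by (simp add: qpoch_def)
    show "norm (D (z * q ^ n)) \<le> exp (1 / (1 - norm q)) * (\<Sum>n. norm z ^ n / (1 - norm a)) +
        (\<Sum>n. norm (qcoeff q a n)) * (exp (1 / (1 - norm q)) / (1 - norm a))" for n
    proof -
      have "norm (jackson_series (z * q ^ n)) \<le>
          (\<Sum>n. norm (qcoeff q a n)) * (exp (1 / (1 - norm q)) / (1 - norm a))"
        unfolding jackson_series_def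
        by (rule norm_suminf_mult_bounded[OF summable_qcoeff[OF q]
              norm_jackson_series_term_le[OF less_imp_le[OF orbit]]])
      moreover have "norm (qpoch_inf q (z * q ^ n) * lambert (z * q ^ n)) \<le>
          exp (1 / (1 - norm q)) * (\<Sum>n. norm z ^ n / (1 - norm a))"
        unfolding norm_mult[of "qpoch_inf _ _"]
        by (intro mult_mono norm_qpoch_inf_le norm_lambert_le q z less_imp_le[OF orbit] orbit_le) auto
      ultimately show ?thesis
        unfolding D_def by (intro order_trans[OF norm_triangle_ineq4] add_mono)
    qed
  qed (rule a)
  then show ?thesis by (simp add: D_def)
qed

lemma qPhi_eq_jackson_series:
  assumes z: "norm z < 1"
  shows "qPhi q [a, a] [a * q, a * z] (q * z) = (1 - a) / qpoch_inf q (a * z) * jackson_series z"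
proof -
  have az: "norm (a * z) < 1"
    using norm_power_mult_less_1[OF z a, of 1] by simp
  have aq: "norm (a * q) < 1"
    using norm_power_mult_less_1[OF q a, of 1] by simp
  have "qPhi q [a, a] [a * q, a * z] (q * z) = (\<Sum>n. (1 - a) / qpoch_inf q (a * z) *
      (qcoeff q a n * ((z * q) ^ n * qpoch_inf q (a * z * q ^ n) / (1 - a * q ^ n))))"
    unfolding qPhi_def
  proof (rule arg_cong[where f = suminf], rule ext)
    fix n
    have nz: "qpoch q (a * z) n \<noteq> 0" "qpoch q (a * q) n \<noteq> 0" "qpoch q q n \<noteq> 0"
      "qpoch_inf q (a * z * q ^ n) \<noteq> 0" "1 - a * q ^ n \<noteq> 0"
      using qpoch_nonzero[OF q az] qpoch_nonzero[OF q aq] qpoch_nonzero[OF q q]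
        qpoch_inf_nonzero[OF q norm_power_mult_less_1[OF q az]] one_minus_nonzero[OF q a] by auto
    \<comment> \<open>Both sides equal \<open>qpoch q a (Suc n)\<close>.\<close>
    have shift: "qpoch q a n * (1 - a * q ^ n) = (1 - a) * qpoch q (a * q) n"
      using qpoch_add[of q a 1 n] qpoch_Suc[of q a n] by (simp add: qpoch_def)
    have "(\<Prod>b\<leftarrow>[a, a]. qpoch q b n) / ((\<Prod>b\<leftarrow>[a * q, a * z]. qpoch q b n) * qpoch q q n) =
      (1 - a) / (1 - a * q ^ n) * (qpoch q a n / (qpoch q (a * z) n * qpoch q q n))"
      using nz shift by (simp add: divide_simps)
    moreover have "qpoch_inf q (a * z * q ^ n) / qpoch_inf q (a * z) = 1 / qpoch q (a * z) n"
      using nz by (simp add: qpoch_inf_split[OF q, of "a * z" n])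
    moreover have "(1 - a) / qpoch_inf q (a * z) *
      (qcoeff q a n * ((z * q) ^ n * qpoch_inf q (a * z * q ^ n) / (1 - a * q ^ n))) =
      (1 - a) * qcoeff q a n * (z * q) ^ n *
        (qpoch_inf q (a * z * q ^ n) / qpoch_inf q (a * z)) / (1 - a * q ^ n)"
      by simp
    ultimately show "(\<Prod>b\<leftarrow>[a, a]. qpoch q b n) / ((\<Prod>b\<leftarrow>[a * q, a * z]. qpoch q b n) * qpoch q q n)
      * ((-1) ^ n * q ^ (n * (n - 1) div 2)) powi (1 + int (length [a * q, a * z]) - int (length [a, a]))
      * (q * z) ^ n = (1 - a) / qpoch_inf q (a * z) *
      (qcoeff q a n * ((z * q) ^ n * qpoch_inf q (a * z * q ^ n) / (1 - a * q ^ n)))"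
      by (simp add: qcoeff_def mult_ac)
  qed
  also have "\<dots> = (1 - a) / qpoch_inf q (a * z) * jackson_series z"
    unfolding jackson_series_def by (rule suminf_mult[OF jackson_series_summable[OF less_imp_le[OF z]]])
  finally show ?thesis .
qed

text \<open>The trace uses this with \<open>a = x\<close> and with \<open>z = (x * y) ^ 2\<close> or
  \<open>z = (x * inverse y) ^ 2\<close>.\<close>

lemma lambert_sums_qPhi:
  assumes z: "norm z < 1"
  shows "(\<lambda>n. z ^ n / (1 - a * q ^ n)) sums
    (qpoch_inf q (a * z) / qpoch_inf q z * qPhi q [a, a] [a * q, a * z] (q * z) / (1 - a))"
proof -
  have az: "norm (a * z) < 1"
    using norm_power_mult_less_1[OF z a, of 1] by simp
  have "1 - a \<noteq> 0" using a by force
  then have "lambert z =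
      qpoch_inf q (a * z) / qpoch_inf q z * qPhi q [a, a] [a * q, a * z] (q * z) / (1 - a)"
    using qpoch_inf_nonzero[OF q z] qpoch_inf_nonzero[OF q az]
    by (simp add: qPhi_eq_jackson_series[OF z] qpoch_inf_mult_lambert[OF z, symmetric])
  then show ?thesis
    unfolding lambert_def[symmetric]
    using summable_sums[OF summable_norm_cancel[OF lambert_summable[OF z]]]
    by (simp add: lambert_def)
qed

end

subsection \<open>Partitions and the trace\<close>

text \<open>Parts are lowered by one, so that all finite multisets of natural numbers occur.\<close>

definition partition_mset :: "nat list \<Rightarrow> nat multiset" where
  "partition_mset lam = image_mset (\<lambda>l. l - 1) (mset lam)"

text \<open>A partition is its multiset of parts listed in decreasing order, and positivity of the
  parts makes \<open>Suc\<close> undo the lowering.\<close>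

lemma bij_betw_partition_mset: "bij_betw partition_mset {lam. is_partition lam} UNIV"
proof (rule bij_betw_byWitness[where f' = "\<lambda>M. rev (sorted_list_of_multiset (image_mset Suc M))"])
  show "\<forall>lam\<in>{lam. is_partition lam}.
      rev (sorted_list_of_multiset (image_mset Suc (partition_mset lam))) = lam"
  proof safe
    fix lam assume lam: "is_partition lam"
    have "image_mset Suc (partition_mset lam) = image_mset (\<lambda>l. l) (mset lam)"
      unfolding partition_mset_def multiset.map_comp
      by (rule image_mset_cong) (use lam in \<open>auto simp: is_partition_def\<close>)
    then have "image_mset Suc (partition_mset lam) = mset lam" by simp
    moreover have "sort lam = rev lam"
      using lam by (intro properties_for_sort) (simp_all add: is_partition_def sorted_wrt_rev)
    ultimately show "rev (sorted_list_of_multiset (image_mset Suc (partition_mset lam))) = lam"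
      by simp
  qed
  show "\<forall>M\<in>UNIV. partition_mset (rev (sorted_list_of_multiset (image_mset Suc M))) = M"
    by (simp add: partition_mset_def multiset.map_comp o_def)
  show "range (\<lambda>M. rev (sorted_list_of_multiset (image_mset Suc M))) \<subseteq> {lam. is_partition lam}"
    by (auto simp: is_partition_def sorted_wrt_rev)
qed simp

lemma power_two_sum_list_minus_length:
  fixes x :: "'a :: comm_monoid_mult"
  assumes "\<forall>l\<in>set lam. 0 < l"
  shows "x ^ (2 * sum_list lam - length lam) = (\<Prod>l\<leftarrow>lam. x ^ (2 * l - 1))"
proof -
  \<comment> \<open>The length bound is carried through the induction so that the subtraction of
    naturals is never truncated.\<close>
  have "length lam \<le> sum_list lam \<and>
      x ^ (2 * sum_list lam - length lam) = (\<Prod>l\<leftarrow>lam. x ^ (2 * l - 1))"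
    using assms
  proof (induction lam)
    case (Cons l lam)
    then have "2 * sum_list (l # lam) - length (l # lam) =
        (2 * l - 1) + (2 * sum_list lam - length lam)"
      by simp
    then have "x ^ (2 * sum_list (l # lam) - length (l # lam)) =
        x ^ (2 * l - 1) * x ^ (2 * sum_list lam - length lam)"
      by (simp only: power_add)
    then show ?case using Cons by simp
  qed simp
  then show ?thesis ..
qed

lemma trace_term_eq_mset_weight:
  assumes "is_partition lam"
  shows "trace_term x y lam =
    mset_weight (\<lambda>i. x ^ (2 * i + 1)) (\<lambda>i. y ^ (2 * i + 1) - inverse y ^ (2 * i + 1))
      (1 / (inverse y - y)) (partition_mset lam)"
proof -
  have pos: "\<forall>l\<in>set lam. 0 < l" using assms by (simp add: is_partition_def)
  \<comment> \<open>Positivity matters: at \<open>l = 0\<close> truncated subtraction would give 1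
    on the left and 0 on the right.\<close>
  have odd: "2 * (l - 1) + 1 = 2 * l - 1" if "l \<in> set lam" for l
    using pos that by (cases l) auto
  have map: "map (\<lambda>l. h (2 * (l - 1) + 1)) lam = map (\<lambda>l. h (2 * l - 1)) lam"
    for h :: "nat \<Rightarrow> complex"
    using odd by (intro map_cong refl) metis
  have prod: "(\<Prod>i\<in>#partition_mset lam. x ^ (2 * i + 1)) = (\<Prod>l\<leftarrow>lam. x ^ (2 * (l - 1) + 1))"
    unfolding partition_mset_def multiset.map_comp o_def mset_map[symmetric] prod_mset_prod_list
    by (simp only: map_map o_def)
  have sum: "(\<Sum>i\<in>#partition_mset lam. y ^ (2 * i + 1) - inverse y ^ (2 * i + 1)) =
      (\<Sum>l\<leftarrow>lam. y ^ (2 * (l - 1) + 1) - inverse y ^ (2 * (l - 1) + 1))"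
    unfolding partition_mset_def multiset.map_comp o_def mset_map[symmetric] sum_mset_sum_list
    by (simp only: map_map o_def)
  show ?thesis
    unfolding trace_term_def mset_weight_def power_two_sum_list_minus_length[OF pos] prod sum
      map[of "\<lambda>k. x ^ k"] map[of "\<lambda>k. y ^ k - inverse y ^ k"] ..
qed

section \<open>Evaluation of the trace\<close>

lemma prod_geometric_factor_LIMSEQ:
  fixes x q :: complex
  assumes "norm q < 1" "norm x < 1"
  shows "(\<lambda>k. \<Prod>i<k. 1 / (1 - x * q ^ i)) \<longlonglongrightarrow> 1 / qpoch_inf q x"
proof -
  have "(\<Prod>i<k. 1 / (1 - x * q ^ i)) = 1 / qpoch q x k" for k
    by (simp add: qpoch_def prod_dividef)
  then show ?thesis
    by (simp only:) (intro tendsto_divide tendsto_const qpoch_LIMSEQ qpoch_inf_nonzero assms)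
qed

text \<open>The real products are embedded in the complex numbers, where their convergence, hence
  boundedness, is known.\<close>

lemma prod_geometric_factor_bounded:
  fixes r s :: real
  assumes "0 \<le> r" "r < 1" "0 \<le> s" "s < 1"
  obtains B where "\<And>k. (\<Prod>i<k. 1 / (1 - s * r ^ i)) \<le> B"
proof -
  have "Bseq (\<lambda>k. \<Prod>i<k. 1 / (1 - complex_of_real s * of_real r ^ i))"
    by (rule convergent_imp_Bseq[OF convergentI[OF prod_geometric_factor_LIMSEQ]])
       (use assms in auto)
  then obtain B where B: "\<And>k. norm (\<Prod>i<k. 1 / (1 - complex_of_real s * of_real r ^ i)) \<le> B"
    by (metis BseqE)
  have "(\<Prod>i<k. 1 / (1 - complex_of_real s * of_real r ^ i)) =
      of_real (\<Prod>i<k. 1 / (1 - s * r ^ i))" for k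
    by simp
  then have "\<bar>\<Prod>i<k. 1 / (1 - s * r ^ i)\<bar> \<le> B" for k
    using B[of k] by (simp only: norm_of_real)
  then show ?thesis using that abs_le_D1 by blast
qed

text \<open>With \<open>u = x * y\<close> and \<open>v = x * inverse y\<close>, the product
  \<open>f i * w i\<close> is a difference of odd powers of \<open>u\<close> and \<open>v\<close>,
  so the mean splits into two Lambert series. The bounds on \<open>norm y\<close> say that
  \<open>u\<close> and \<open>v\<close> lie in the open unit disc.\<close>

lemma trace_has_sum_lambert:
  fixes x y :: complex
  assumes x: "norm x < 1" and xy: "norm x < norm y" "norm x * norm y < 1"
    and S1: "(\<lambda>n. ((x * y) ^ 2) ^ n / (1 - x * (x ^ 2) ^ n)) sums S1"
    and S2: "(\<lambda>n. ((x * inverse y) ^ 2) ^ n / (1 - x * (x ^ 2) ^ n)) sums S2"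
  shows "(trace_term x y has_sum
    1 / qpoch_inf (x ^ 2) x * (x * y * S1 - x * inverse y * S2 + 1 / (inverse y - y)))
    {lam. is_partition lam}"
proof -
  define w where "w = (\<lambda>i::nat. x ^ (2 * i + 1))"
  define f where "f = (\<lambda>i::nat. y ^ (2 * i + 1) - inverse y ^ (2 * i + 1))"
  define c where "c = 1 / (inverse y - y)"
  define u where "u = x * y"
  define v where "v = x * inverse y"
  have q: "norm (x ^ 2) < 1"
    using x by (simp add: norm_power power_less_one_iff)
  have u: "norm u < 1" using xy by (simp add: u_def norm_mult)
  have v: "norm v < 1" using xy order_le_less_trans[OF norm_ge_zero xy(1)]
    by (simp add: v_def norm_mult norm_inverse norm_divide field_simps)
  have w: "w i = x * (x ^ 2) ^ i" for i by (simp add: w_def power_mult)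
  have fw: "f i * w i = u * (u ^ 2) ^ i - v * (v ^ 2) ^ i" for i
    by (simp add: f_def w_def u_def v_def power_mult[symmetric] algebra_simps)
  have w_lt: "norm (w i) < 1" for i
    unfolding w by (rule norm_power_mult_less_1[OF q x])
  have "(\<lambda>k. \<Sum>i<k. f i * w i / (1 - w i)) \<longlonglongrightarrow> u * S1 - v * S2"
  proof -
    have "(\<lambda>i. u * ((u ^ 2) ^ i / (1 - w i)) - v * ((v ^ 2) ^ i / (1 - w i))) sums (u * S1 - v * S2)"
      using S1 S2 unfolding w u_def v_def by (intro sums_diff sums_mult)
    then show ?thesis
      unfolding sums_def fw by (simp add: diff_divide_distrib)
  qed
  then have lim: "(\<lambda>k. weight_total w f c {..<k}) \<longlonglongrightarrow>
      1 / qpoch_inf (x ^ 2) x * (u * S1 - v * S2 + c)"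
    unfolding weight_total_def using prod_geometric_factor_LIMSEQ[OF q x]
    by (intro tendsto_intros) (simp_all add: w)
  obtain B1 where "(\<Prod>i<k. 1 / (1 - norm x * norm (x ^ 2) ^ i)) \<le> B1" for k
    by (rule prod_geometric_factor_bounded[of "norm (x ^ 2)" "norm x"]) (use q x in auto)
  then have B1: "(\<Prod>i<k. 1 / (1 - norm (w i))) \<le> B1" for k
    by (simp add: w norm_mult norm_power)
  \<comment> \<open>A summable majorant: \<open>norm (w i) \<le> norm x\<close> replaces all
    denominators by \<open>1 - norm x\<close>.\<close>
  define b where "b i = (norm u * (norm u ^ 2) ^ i + norm v * (norm v ^ 2) ^ i) / (1 - norm x)" for i
  have b_summable: "summable b"
    unfolding b_def using u v
    by (intro summable_divide summable_add summable_mult summable_geometric)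
       (simp_all add: power_less_one_iff)
  have fw_le: "norm (f i) * norm (w i) / (1 - norm (w i)) \<le> b i" for i
  proof -
    have "norm (f i) * norm (w i) \<le> norm u * (norm u ^ 2) ^ i + norm v * (norm v ^ 2) ^ i"
      unfolding norm_mult[symmetric] fw
      by (rule order_trans[OF norm_triangle_ineq4]) (simp add: norm_mult norm_power)
    moreover have "norm (w i) \<le> norm x"
      unfolding w norm_mult norm_power[of _ i] using q
      by (intro mult_left_le power_le_one) auto
    ultimately show ?thesis
      unfolding b_def using x by (intro frac_le) auto
  qed
  have bdd: "weight_total (\<lambda>i. norm (w i)) (\<lambda>i. norm (f i)) (norm c) {..<k} \<le>
      B1 * (suminf b + norm c)" for k
  proof -
    have "(\<Sum>i<k. norm (f i) * norm (w i) / (1 - norm (w i))) \<le> (\<Sum>i<k. b i)"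
      by (intro sum_mono fw_le)
    also have "\<dots> \<le> suminf b"
      using x by (intro sum_le_suminf[OF b_summable]) (auto simp: b_def)
    \<comment> \<open>Monotonicity of the product needs \<open>B1\<close> nonnegative, which follows
      since it bounds a product of nonnegative factors.\<close>
    finally show ?thesis
      unfolding weight_total_def using B1[of k] less_imp_le[OF w_lt]
      by (intro mult_mono add_mono)
         (auto intro!: add_nonneg_nonneg sum_nonneg prod_nonneg order_trans[OF prod_nonneg B1[of k]])
  qed
  have "(mset_weight w f c has_sum 1 / qpoch_inf (x ^ 2) x * (u * S1 - v * S2 + c)) UNIV"
    by (rule mset_weight_has_sum_lim[OF w_lt lim bdd])
  then have "((\<lambda>lam. mset_weight w f c (partition_mset lam)) has_sum
      1 / qpoch_inf (x ^ 2) x * (u * S1 - v * S2 + c)) {lam. is_partition lam}"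
    by (subst has_sum_reindex_bij_betw[OF bij_betw_partition_mset])
  then show ?thesis
    unfolding u_def v_def c_def
    by (subst has_sum_cong[OF trace_term_eq_mset_weight]) (simp_all add: w_def f_def c_def)
qed

text \<open>Fixing the square roots \<open>x\<close> of \<open>q\<close> and \<open>y\<close> of
  \<open>t\<close> makes the half-integral powers unambiguous. The norm conditions on
  \<open>y\<close> give \<open>norm (t * q) < 1\<close> and \<open>norm (inverse t * q) < 1\<close>,
  so both Lambert series converge.\<close>

theorem theorem3p2:
  fixes x y :: complex
  assumes "0 < norm x" and "norm x < 1"
    and "norm x < norm y" and "norm x * norm y < 1"
    and "y ^ 2 \<noteq> 1"
  defines "q \<equiv> x ^ 2" and "t \<equiv> y ^ 2"
  shows "(trace_term x y has_sum
     (1 / (qpoch_inf q x * (inverse y - y))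
      - 1 / (qpoch_inf q x * (1 - inverse x))
          * (y * qpoch_inf q (t * x ^ 3) / qpoch_inf q (t * q))
          * qPhi q [x, x] [x ^ 3, t * x ^ 3] (q ^ 2 * t)
      + 1 / (qpoch_inf q x * (1 - inverse x))
          * (inverse y * qpoch_inf q (inverse t * x ^ 3) / qpoch_inf q (inverse t * q))
          * qPhi q [x, x] [x ^ 3, inverse t * x ^ 3] (q ^ 2 * inverse t)))
     {lam. is_partition lam}"
proof -
  have q: "norm q < 1" and x0: "x \<noteq> 0" "1 - x \<noteq> 0"
    using assms(1,2) by (auto simp: q_def norm_power power_less_one_iff)
  have "norm (x * y) < 1" using assms(4) by (simp add: norm_mult)
  then have z1: "norm ((x * y) ^ 2) < 1"
    by (simp add: norm_power power_less_one_iff)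
  have "norm (x * inverse y) < 1"
    using assms(3) order_le_less_trans[OF norm_ge_zero assms(3)]
    by (simp add: norm_mult norm_inverse norm_divide field_simps)
  then have z2: "norm ((x * inverse y) ^ 2) < 1"
    by (simp add: norm_power power_less_one_iff)
  have e1: "(x * y) ^ 2 = t * q" "x * (t * q) = t * x ^ 3" "q * (t * q) = q ^ 2 * t"
    "(x * inverse y) ^ 2 = inverse t * q" "x * (inverse t * q) = inverse t * x ^ 3"
    "q * (inverse t * q) = q ^ 2 * inverse t" "x * q = x ^ 3"
    by (simp_all add: q_def t_def power2_eq_square power3_eq_cube mult_ac)
  \<comment> \<open>The stated prefactor has \<open>1 - inverse x\<close> where the Lambert series
    give \<open>x / (1 - x)\<close>; the change of sign accounts for the signs of the two
    \<open>2Phi2\<close> terms.\<close>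
  have coef: "1 / (E * (1 - inverse x)) = - (x / (E * (1 - x)))" for E :: complex
    using x0 by (cases "E = 0") (simp_all add: divide_simps algebra_simps)
  note S1 = lambert_sums_qPhi[OF q assms(2) z1, unfolded e1]
  note S2 = lambert_sums_qPhi[OF q assms(2) z2, unfolded e1]
  have "(trace_term x y has_sum
    1 / qpoch_inf q x *
     (x * y * (qpoch_inf q (t * x ^ 3) / qpoch_inf q (t * q) *
        qPhi q [x, x] [x ^ 3, t * x ^ 3] (q ^ 2 * t) / (1 - x)) -
      x * inverse y * (qpoch_inf q (inverse t * x ^ 3) / qpoch_inf q (inverse t * q) *
        qPhi q [x, x] [x ^ 3, inverse t * x ^ 3] (q ^ 2 * inverse t) / (1 - x)) +
      1 / (inverse y - y))) {lam. is_partition lam}"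
    unfolding q_def
    by (rule trace_has_sum_lambert[OF assms(2-4)])
       (use S1 S2 in \<open>simp_all only: e1 q_def[symmetric]\<close>)
  then show ?thesis
    unfolding coef by (simp add: algebra_simps)
qed

end
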